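(* Let $R$ be a commutative Krasner hyperring with nonzero identity satisfying the strong annihilator condition, let $\delta$ be an expansion of hyperideals, and let $P$ be a proper hyperideal of $R$. Then $P$ is a $\delta$-$r$-hyperideal if and only if for every finitely generated hyperideal $N$ of $R$ and every hyperideal $M$ of $R$, the conditions $N\cdot M\subseteq P$ and $ann(N)=0$ imply $M\subseteq\delta(P)$.
   Context: A Krasner hyperring $(R,+,\cdot)$ is a set where $(R,+)$ is a canonical hypergroup (a commutative, associative hyperoperation with values nonempty subsets, an element $0$ with $x+0=\{x\}$, unique opposites $-x$ with $0\in x+(-x)$, and $z\in x+y$ implies $y\in -x+z$ and $x\in z-y$), $(R,\cdot)$ is a semigroup (single-valued multiplication) with $0$ bilaterally absorbing, and $\cdot$ is distributive over $+$. It is commutative with nonzero identity if $\cdot$ is commutative with an identity $1\neq 0$. A hyperideal is a nonempty $N\subseteq R$ with $x-y\subseteq N$ and $rx\in N$ for all $x,y\in N$, $r\in R$. For $a\in R$, $ann(a)=\{r\in R: ra=0\}$; for $A\subseteq R$, $ann(A)=\{r\in R: rx=0 \text{ for all } x\in A\}$; "$ann(\cdot)=0$" means it equals $\{0\}$. The product $N\cdot M$ of hyperideals is the union of all finite sums $a_1b_1+\cdots+a_kb_k$ with $a_i\in N$, $b_i\in M$. A hyperideal expansion is a function $\delta$ assigning to each hyperideal $N$ a hyperideal $\delta(N)$ of the same hyperring such that $N\subseteq\delta(N)$, and $P\subseteq Q$ implies $\delta(P)\subseteq\delta(Q)$. A proper hyperideal $N$ is a $\delta$-$r$-hyperideal if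 for all $a,b\in R$, $a\cdot b\in N$ and $ann(a)=0$ imply $b\in\delta(N)$. $R$ satisfies the strong annihilator condition if for every finitely generated hyperideal $N$ of $R$ there is $a\in N$ with $ann(a)=ann(N)$. *)

theory Defs
  imports "HOL-Algebra.Group"
begin

record 'a hyperring = "'a monoid" +
  hzero :: 'a (\<open>\<zero>\<^sub>h\<index>\<close>)
  hadd :: "'a \<Rightarrow> 'a \<Rightarrow> 'a set" (infixl \<open>\<boxplus>\<index>\<close> 65)

(* The opposite is the unique y with 0 in x + y; uniqueness is an axiom of canonical hypergroups. *)
definition hopp :: "('a, 'm) hyperring_scheme \<Rightarrow> 'a \<Rightarrow> 'a" (\<open>\<boxminus>\<index> _\<close> [81] 80) where
  "hopp R x = (THE y. y \<in> carrier R \<and> \<zero>\<^sub>h\<^bsub>R\<^esub> \<in> x \<boxplus>\<^bsub>R\<^esub> y)"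

(* (x + y) + z and x + (y + z) are read elementwise, as unions. *)
locale canonical_hypergroup =
  fixes R :: "('a, 'm) hyperring_scheme" (structure)
  assumes hadd_closed: "\<lbrakk>x \<in> carrier R; y \<in> carrier R\<rbrakk> \<Longrightarrow> x \<boxplus> y \<subseteq> carrier R"
    and hadd_nonempty: "\<lbrakk>x \<in> carrier R; y \<in> carrier R\<rbrakk> \<Longrightarrow> x \<boxplus> y \<noteq> {}"
    and hadd_comm: "\<lbrakk>x \<in> carrier R; y \<in> carrier R\<rbrakk> \<Longrightarrow> x \<boxplus> y = y \<boxplus> x"
    and hadd_assoc: "\<lbrakk>x \<in> carrier R; y \<in> carrier R; z \<in> carrier R\<rbrakk> \<Longrightarrow>
      (\<Union>u\<in>x \<boxplus> y. u \<boxplus> z) = (\<Union>v\<in>y \<boxplus> z. x \<boxplus> v)"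
    and hzero_closed: "\<zero>\<^sub>h \<in> carrier R"
    and hadd_zero: "x \<in> carrier R \<Longrightarrow> x \<boxplus> \<zero>\<^sub>h = {x}"
    and hopp_unique: "x \<in> carrier R \<Longrightarrow> \<exists>!y. y \<in> carrier R \<and> \<zero>\<^sub>h \<in> x \<boxplus> y"
    and hadd_reversible: "\<lbrakk>x \<in> carrier R; y \<in> carrier R; z \<in> x \<boxplus> y\<rbrakk> \<Longrightarrow>
      y \<in> (\<boxminus> x) \<boxplus> z \<and> x \<in> z \<boxplus> (\<boxminus> y)"

locale krasner_hyperring = canonical_hypergroup R for R :: "('a, 'm) hyperring_scheme" (structure) +
  assumes hmult_closed: "\<lbrakk>x \<in> carrier R; y \<in> carrier R\<rbrakk> \<Longrightarrow> x \<otimes> y \<in> carrier R"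
    and hmult_assoc: "\<lbrakk>x \<in> carrier R; y \<in> carrier R; z \<in> carrier R\<rbrakk> \<Longrightarrow>
      (x \<otimes> y) \<otimes> z = x \<otimes> (y \<otimes> z)"
    and hzero_absorb_left: "x \<in> carrier R \<Longrightarrow> \<zero>\<^sub>h \<otimes> x = \<zero>\<^sub>h"
    and hzero_absorb_right: "x \<in> carrier R \<Longrightarrow> x \<otimes> \<zero>\<^sub>h = \<zero>\<^sub>h"
    and hdistrib_left: "\<lbrakk>x \<in> carrier R; y \<in> carrier R; z \<in> carrier R\<rbrakk> \<Longrightarrow>
      (\<lambda>u. z \<otimes> u) ` (x \<boxplus> y) = (z \<otimes> x) \<boxplus> (z \<otimes> y)"
    and hdistrib_right: "\<lbrakk>x \<in> carrier R; y \<in> carrier R; z \<in> carrier R\<rbrakk> \<Longrightarrow>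
      (\<lambda>u. u \<otimes> z) ` (x \<boxplus> y) = (x \<otimes> z) \<boxplus> (y \<otimes> z)"

locale comm_krasner_hyperring = krasner_hyperring R + comm_monoid R
  for R :: "('a, 'm) hyperring_scheme" (structure) +
  assumes one_not_hzero: "\<one> \<noteq> \<zero>\<^sub>h"

definition hyperideal :: "('a, 'm) hyperring_scheme \<Rightarrow> 'a set \<Rightarrow> bool" where
  "hyperideal R N \<longleftrightarrow> N \<subseteq> carrier R \<and> N \<noteq> {} \<and>
     (\<forall>x\<in>N. \<forall>y\<in>N. x \<boxplus>\<^bsub>R\<^esub> (\<boxminus>\<^bsub>R\<^esub> y) \<subseteq> N) \<and>
     (\<forall>r\<in>carrier R. \<forall>x\<in>N. r \<otimes>\<^bsub>R\<^esub> x \<in> N)"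

definition proper_hyperideal :: "('a, 'm) hyperring_scheme \<Rightarrow> 'a set \<Rightarrow> bool" where
  "proper_hyperideal R N \<longleftrightarrow> hyperideal R N \<and> N \<noteq> carrier R"

definition hyperideal_gen :: "('a, 'm) hyperring_scheme \<Rightarrow> 'a set \<Rightarrow> 'a set" where
  "hyperideal_gen R A = \<Inter>{N. hyperideal R N \<and> A \<subseteq> N}"

definition fin_gen_hyperideal :: "('a, 'm) hyperring_scheme \<Rightarrow> 'a set \<Rightarrow> bool" where
  "fin_gen_hyperideal R N \<longleftrightarrow>
     hyperideal R N \<and> (\<exists>A. finite A \<and> A \<subseteq> carrier R \<and> N = hyperideal_gen R A)"

definition elem_ann :: "('a, 'm) hyperring_scheme \<Rightarrow> 'a \<Rightarrow> 'a set" where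
  "elem_ann R a = {r \<in> carrier R. r \<otimes>\<^bsub>R\<^esub> a = \<zero>\<^sub>h\<^bsub>R\<^esub>}"

definition set_ann :: "('a, 'm) hyperring_scheme \<Rightarrow> 'a set \<Rightarrow> 'a set" where
  "set_ann R A = {r \<in> carrier R. \<forall>x\<in>A. r \<otimes>\<^bsub>R\<^esub> x = \<zero>\<^sub>h\<^bsub>R\<^esub>}"

(* The set x_1 + ... + x_k. The base case {0} only serves the recursion: x + 0 = {x}. *)
primrec hsum_list :: "('a, 'm) hyperring_scheme \<Rightarrow> 'a list \<Rightarrow> 'a set" where
  "hsum_list R [] = {\<zero>\<^sub>h\<^bsub>R\<^esub>}"
| "hsum_list R (x # xs) = (\<Union>u\<in>hsum_list R xs. x \<boxplus>\<^bsub>R\<^esub> u)"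

definition hyperideal_prod :: "('a, 'm) hyperring_scheme \<Rightarrow> 'a set \<Rightarrow> 'a set \<Rightarrow> 'a set" where
  "hyperideal_prod R N M =
     \<Union>{hsum_list R (map (\<lambda>(a, b). a \<otimes>\<^bsub>R\<^esub> b) ps) | ps. ps \<noteq> [] \<and> set ps \<subseteq> N \<times> M}"

(* Only the values of \<delta> on hyperideals of R matter. *)
definition hyperideal_expansion :: "('a, 'm) hyperring_scheme \<Rightarrow> ('a set \<Rightarrow> 'a set) \<Rightarrow> bool" where
  "hyperideal_expansion R \<delta> \<longleftrightarrow>
     (\<forall>N. hyperideal R N \<longrightarrow> hyperideal R (\<delta> N) \<and> N \<subseteq> \<delta> N) \<and>
     (\<forall>P Q. hyperideal R P \<longrightarrow> hyperideal R Q \<longrightarrow> P \<subseteq> Q \<longrightarrow> \<delta> P \<subseteq> \<delta> Q)"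

definition delta_r_hyperideal ::
  "('a, 'm) hyperring_scheme \<Rightarrow> ('a set \<Rightarrow> 'a set) \<Rightarrow> 'a set \<Rightarrow> bool" where
  "delta_r_hyperideal R \<delta> N \<longleftrightarrow> proper_hyperideal R N \<and>
     (\<forall>a\<in>carrier R. \<forall>b\<in>carrier R.
        a \<otimes>\<^bsub>R\<^esub> b \<in> N \<longrightarrow> elem_ann R a = {\<zero>\<^sub>h\<^bsub>R\<^esub>} \<longrightarrow> b \<in> \<delta> N)"

definition strong_annihilator_condition :: "('a, 'm) hyperring_scheme \<Rightarrow> bool" where
  "strong_annihilator_condition R \<longleftrightarrow>
     (\<forall>N. fin_gen_hyperideal R N \<longrightarrow> (\<exists>a\<in>N. elem_ann R a = set_ann R N))"

end

theory Submission
  imports Defs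
begin

text \<open>
  The condition on hyperideals reduces to the condition on elements because, as far as annihilators
  are concerned, a finitely generated hyperideal can be replaced by a single element: by one of its
  own members in one direction, by the generator of a principal hyperideal in the other.

  If \<open>P\<close> is a \<open>\<delta>\<close>-\<open>r\<close>-hyperideal and \<open>N\<close> is finitely generated with \<open>ann N = 0\<close>, the strong
  annihilator condition replaces \<open>N\<close> by one element \<open>a \<in> N\<close> with \<open>ann a = 0\<close>. For every \<open>b \<in> M\<close> the
  product \<open>a \<cdot> b\<close> lies in \<open>N \<cdot> M \<subseteq> P\<close>, whence \<open>b \<in> \<delta> P\<close>.

  Conversely, let \<open>a \<cdot> b \<in> P\<close> with \<open>ann a = 0\<close>. The condition on hyperideals is applied to the
  principal hyperideals generated by \<open>a\<close> and \<open>b\<close>. By distributivity and the presence of an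
  identity these are just the sets of multiples \<open>R a\<close> and \<open>R b\<close> (\<open>hyperideal_gen_singleton\<close>), so
  \<open>ann (R a) = ann a\<close>, and the generators \<open>(r a) (s b) = (r s) (a b)\<close> of the product \<open>R a \<cdot> R b\<close> all
  lie in \<open>P\<close>. Since \<open>P\<close> is closed under finite hypersums, \<open>R a \<cdot> R b \<subseteq> P\<close>, and therefore
  \<open>b \<in> R b \<subseteq> \<delta> P\<close>.
\<close>

lemma (in canonical_hypergroup) hopp_closed: "x \<in> carrier R \<Longrightarrow> \<boxminus> x \<in> carrier R"
  and hzero_in_hadd_hopp: "x \<in> carrier R \<Longrightarrow> \<zero>\<^sub>h \<in> x \<boxplus> (\<boxminus> x)"
  unfolding hopp_def using theI'[OF hopp_unique[of x]] by blast+

lemma (in canonical_hypergroup) hopp_eqI: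
  "\<lbrakk>x \<in> carrier R; y \<in> carrier R; \<zero>\<^sub>h \<in> x \<boxplus> y\<rbrakk> \<Longrightarrow> \<boxminus> x = y"
  using hopp_unique[of x] hopp_closed[of x] hzero_in_hadd_hopp[of x] by blast

lemma (in canonical_hypergroup) hopp_hopp:
  assumes "x \<in> carrier R"
  shows "\<boxminus> (\<boxminus> x) = x"
  using assms hopp_closed hzero_in_hadd_hopp hadd_comm by (intro hopp_eqI) auto

lemma (in canonical_hypergroup) hyperideal_hzero:
  assumes "hyperideal R N"
  shows "\<zero>\<^sub>h \<in> N"
proof -
  obtain x where "x \<in> N" "x \<in> carrier R" using assms unfolding hyperideal_def by blast
  then show ?thesis using assms hzero_in_hadd_hopp unfolding hyperideal_def by blast
qed

lemma (in canonical_hypergroup) hyperideal_hopp: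
  assumes "hyperideal R N" "y \<in> N"
  shows "\<boxminus> y \<in> N"
proof -
  have y: "\<boxminus> y \<in> carrier R" using assms hopp_closed unfolding hyperideal_def by blast
  have "\<zero>\<^sub>h \<boxplus> (\<boxminus> y) \<subseteq> N"
    using assms hyperideal_hzero unfolding hyperideal_def by blast
  then show ?thesis using hadd_zero[OF y] hadd_comm[OF y hzero_closed] by simp
qed

text \<open>Hyperideals are defined through differences; sums are recovered as \<open>x + y = x - (- y)\<close>.\<close>

lemma (in canonical_hypergroup) hyperideal_hadd:
  assumes "hyperideal R N" "x \<in> N" "y \<in> N"
  shows "x \<boxplus> y \<subseteq> N"
proof -
  have "y \<in> carrier R" using assms unfolding hyperideal_def by blast
  moreover have "x \<boxplus> (\<boxminus> (\<boxminus> y)) \<subseteq> N"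
    using assms hyperideal_hopp[OF assms(1,3)] unfolding hyperideal_def by blast
  ultimately show ?thesis using hopp_hopp by simp
qed

lemma (in canonical_hypergroup) hyperideal_hsum_list:
  assumes "hyperideal R N"
  shows "set xs \<subseteq> N \<Longrightarrow> hsum_list R xs \<subseteq> N"
proof (induction xs)
  case Nil
  then show ?case using hyperideal_hzero[OF assms] by simp
next
  case (Cons x xs)
  then have "x \<in> N" "hsum_list R xs \<subseteq> N" by auto
  then have "x \<boxplus> u \<subseteq> N" if "u \<in> hsum_list R xs" for u
    using that hyperideal_hadd[OF assms] by blast
  then show ?case by (simp add: UN_subset_iff)
qed

lemma (in canonical_hypergroup) hyperideal_prod_subset:
  assumes "hyperideal R P" "\<And>x y. \<lbrakk>x \<in> N; y \<in> M\<rbrakk> \<Longrightarrow> x \<otimes> y \<in> P"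
  shows "hyperideal_prod R N M \<subseteq> P"
proof -
  have "hsum_list R (map (\<lambda>(x, y). x \<otimes> y) ps) \<subseteq> P" if "set ps \<subseteq> N \<times> M" for ps
    using that assms(2) by (intro hyperideal_hsum_list[OF assms(1)]) auto
  then show ?thesis unfolding hyperideal_prod_def by blast
qed

lemma (in krasner_hyperring) mult_in_hyperideal_prod:
  assumes "x \<in> N" "y \<in> M" "x \<in> carrier R" "y \<in> carrier R"
  shows "x \<otimes> y \<in> hyperideal_prod R N M"
proof -
  \<comment> \<open>The one-term hypersum is \<open>x \<cdot> y + 0\<close>, a singleton.\<close>
  have "x \<otimes> y \<in> hsum_list R (map (\<lambda>(x, y). x \<otimes> y) [(x, y)])"
    using assms hmult_closed hadd_zero by simp
  moreover have "[(x, y)] \<noteq> []" "set [(x, y)] \<subseteq> N \<times> M" using assms by auto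
  ultimately show ?thesis unfolding hyperideal_prod_def by blast
qed

lemma (in krasner_hyperring) hopp_mult_left:
  assumes "x \<in> carrier R" "z \<in> carrier R"
  shows "\<boxminus> (x \<otimes> z) = (\<boxminus> x) \<otimes> z"
proof (rule hopp_eqI)
  have "\<zero>\<^sub>h \<otimes> z \<in> (\<lambda>u. u \<otimes> z) ` (x \<boxplus> (\<boxminus> x))"
    using hzero_in_hadd_hopp assms by blast
  then show "\<zero>\<^sub>h \<in> (x \<otimes> z) \<boxplus> ((\<boxminus> x) \<otimes> z)"
    using assms hopp_closed hdistrib_right hzero_absorb_left by simp
qed (use assms hopp_closed hmult_closed in auto)

text \<open>
  Full distributivity gives \<open>r a - s a = (r - s) a\<close> as an equality of sets, so the multiples of one
  element are already closed under hyperdifferences and no sums of multiples are needed. The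
  inclusion of \<open>r a - s a\<close> in \<open>(r - s) a\<close> is the one that matters.
\<close>

lemma (in krasner_hyperring) hyperideal_multiples:
  assumes "a \<in> carrier R"
  shows "hyperideal R ((\<lambda>r. r \<otimes> a) ` carrier R)"
  unfolding hyperideal_def
proof (intro conjI ballI)
  fix x y assume "x \<in> (\<lambda>r. r \<otimes> a) ` carrier R" "y \<in> (\<lambda>r. r \<otimes> a) ` carrier R"
  then obtain r s where rs: "r \<in> carrier R" "x = r \<otimes> a" "s \<in> carrier R" "y = s \<otimes> a" by blast
  have "x \<boxplus> (\<boxminus> y) = (\<lambda>u. u \<otimes> a) ` (r \<boxplus> (\<boxminus> s))"
    using rs assms hopp_mult_left hdistrib_right hopp_closed by simp
  moreover have "r \<boxplus> (\<boxminus> s) \<subseteq> carrier R" using rs hopp_closed hadd_closed by simp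
  ultimately show "x \<boxplus> (\<boxminus> y) \<subseteq> (\<lambda>r. r \<otimes> a) ` carrier R" by blast
next
  fix t x assume t: "t \<in> carrier R" and "x \<in> (\<lambda>r. r \<otimes> a) ` carrier R"
  then obtain r where r: "r \<in> carrier R" "x = r \<otimes> a" by blast
  then have "t \<otimes> x = (t \<otimes> r) \<otimes> a" using t assms hmult_assoc by simp
  then show "t \<otimes> x \<in> (\<lambda>r. r \<otimes> a) ` carrier R" using t r hmult_closed by blast
qed (use assms hmult_closed hzero_closed in auto)

context comm_krasner_hyperring
begin

lemma self_in_multiples:
  "a \<in> carrier R \<Longrightarrow> a \<in> (\<lambda>r. r \<otimes> a) ` carrier R"
  by (rule image_eqI[of _ _ \<one>]) auto

lemma hyperideal_gen_singleton:
  assumes "a \<in> carrier R"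
  shows "hyperideal_gen R {a} = (\<lambda>r. r \<otimes> a) ` carrier R"
proof
  show "hyperideal_gen R {a} \<subseteq> (\<lambda>r. r \<otimes> a) ` carrier R"
    using assms hyperideal_multiples self_in_multiples unfolding hyperideal_gen_def by blast
  show "(\<lambda>r. r \<otimes> a) ` carrier R \<subseteq> hyperideal_gen R {a}"
    unfolding hyperideal_gen_def hyperideal_def by blast
qed

lemma fin_gen_hyperideal_multiples:
  assumes "a \<in> carrier R"
  shows "fin_gen_hyperideal R ((\<lambda>r. r \<otimes> a) ` carrier R)"
proof -
  have "finite {a}" "{a} \<subseteq> carrier R" using assms by auto
  then show ?thesis
    unfolding fin_gen_hyperideal_def
    using hyperideal_multiples[OF assms] hyperideal_gen_singleton[OF assms] by metis
qed

lemma set_ann_multiples: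
  assumes "a \<in> carrier R"
  shows "set_ann R ((\<lambda>r. r \<otimes> a) ` carrier R) = elem_ann R a"
proof
  show "set_ann R ((\<lambda>r. r \<otimes> a) ` carrier R) \<subseteq> elem_ann R a"
    using self_in_multiples[OF assms] unfolding set_ann_def elem_ann_def by blast
  show "elem_ann R a \<subseteq> set_ann R ((\<lambda>r. r \<otimes> a) ` carrier R)"
  proof
    fix t assume "t \<in> elem_ann R a"
    then have t: "t \<in> carrier R" "t \<otimes> a = \<zero>\<^sub>h" unfolding elem_ann_def by auto
    have "t \<otimes> (r \<otimes> a) = \<zero>\<^sub>h" if r: "r \<in> carrier R" for r
      using m_lcomm[OF t(1) r assms] t(2) hzero_absorb_right[OF r] by simp
    then show "t \<in> set_ann R ((\<lambda>r. r \<otimes> a) ` carrier R)"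
      using t(1) unfolding set_ann_def by blast
  qed
qed

lemma prod_multiples_subset:
  assumes "hyperideal R P" "a \<in> carrier R" "b \<in> carrier R" "a \<otimes> b \<in> P"
  shows "hyperideal_prod R ((\<lambda>r. r \<otimes> a) ` carrier R) ((\<lambda>r. r \<otimes> b) ` carrier R) \<subseteq> P"
proof (rule hyperideal_prod_subset[OF assms(1)])
  fix x y assume "x \<in> (\<lambda>r. r \<otimes> a) ` carrier R" "y \<in> (\<lambda>r. r \<otimes> b) ` carrier R"
  then obtain r s where rs: "r \<in> carrier R" "x = r \<otimes> a" "s \<in> carrier R" "y = s \<otimes> b" by blast
  then have "x \<otimes> y = (r \<otimes> s) \<otimes> (a \<otimes> b)"
    using assms(2,3) by (simp add: m_ac)
  then show "x \<otimes> y \<in> P" using rs assms unfolding hyperideal_def by simp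
qed

end

theorem theorem2p5:
  fixes R :: "('a, 'm) hyperring_scheme" and \<delta> :: "'a set \<Rightarrow> 'a set" and P :: "'a set"
  assumes "comm_krasner_hyperring R"
    and "strong_annihilator_condition R"
    and "hyperideal_expansion R \<delta>"
    and "proper_hyperideal R P"
  shows "delta_r_hyperideal R \<delta> P \<longleftrightarrow>
    (\<forall>N M. fin_gen_hyperideal R N \<longrightarrow> hyperideal R M \<longrightarrow>
       hyperideal_prod R N M \<subseteq> P \<longrightarrow> set_ann R N = {\<zero>\<^sub>h\<^bsub>R\<^esub>} \<longrightarrow> M \<subseteq> \<delta> P)"
proof (intro iffI allI impI subsetI)
  interpret comm_krasner_hyperring R by fact
  fix N M b
  assume r: "delta_r_hyperideal R \<delta> P" and N: "fin_gen_hyperideal R N"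
    and M: "hyperideal R M" and NM: "hyperideal_prod R N M \<subseteq> P"
    and ann: "set_ann R N = {\<zero>\<^sub>h\<^bsub>R\<^esub>}" and b: "b \<in> M"
  obtain a where a: "a \<in> N" "elem_ann R a = {\<zero>\<^sub>h\<^bsub>R\<^esub>}"
    using assms(2) N ann unfolding strong_annihilator_condition_def by metis
  have carr: "a \<in> carrier R" "b \<in> carrier R"
    using a(1) b N M unfolding fin_gen_hyperideal_def hyperideal_def by blast+
  have "a \<otimes>\<^bsub>R\<^esub> b \<in> P" using mult_in_hyperideal_prod a(1) b carr NM by blast
  then show "b \<in> \<delta> P" using r a(2) carr unfolding delta_r_hyperideal_def by blast
next
  interpret comm_krasner_hyperring R by fact
  assume H: "\<forall>N M. fin_gen_hyperideal R N \<longrightarrow> hyperideal R M \<longrightarrow>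
       hyperideal_prod R N M \<subseteq> P \<longrightarrow> set_ann R N = {\<zero>\<^sub>h\<^bsub>R\<^esub>} \<longrightarrow> M \<subseteq> \<delta> P"
  have P: "hyperideal R P" using assms(4) unfolding proper_hyperideal_def by blast
  have "b \<in> \<delta> P"
    if a: "a \<in> carrier R" and b: "b \<in> carrier R" and ab: "a \<otimes>\<^bsub>R\<^esub> b \<in> P"
      and ann: "elem_ann R a = {\<zero>\<^sub>h\<^bsub>R\<^esub>}" for a b
  proof -
    have "(\<lambda>r. r \<otimes>\<^bsub>R\<^esub> b) ` carrier R \<subseteq> \<delta> P"
      using H fin_gen_hyperideal_multiples[OF a] hyperideal_multiples[OF b]
        prod_multiples_subset[OF P a b ab] set_ann_multiples[OF a] ann by metis
    then show ?thesis using self_in_multiples[OF b] by blast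
  qed
  then show "delta_r_hyperideal R \<delta> P"
    using assms(4) unfolding delta_r_hyperideal_def by blast
qed

end
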